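(* In the case $N=4$ (with multiplicity function $k=0$), for $z\in\mathbb{C}$ with $\operatorname{Re}z>0$, the integral kernel $K_0$ of $\exp(z|x|^2\Delta)$ is given by $$K_0(r\omega,r'\omega';z)=-\frac{1}{8\pi^3\sqrt{4\pi z}}\exp\Bigl(-\frac{(\log r-\log r')^2}{4z}\Bigr)(rr')^{-1}\bigl(1-\langle\omega,\omega'\rangle^2\bigr)^{-\frac12}\,\frac{\partial\vartheta}{\partial v}\Bigl(\frac1{2\pi}\arccos\langle\omega,\omega'\rangle,\frac{\mathrm{i}}{\pi}z\Bigr)$$ for $r,r'\in\mathbb{R}_{>0}$ and $\omega,\omega'\in S^3$. Here the branch of $\arccos\langle\omega,\omega'\rangle$ is taken such that $\arccos\langle\omega,\omega'\rangle\in[0,\pi]$.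
   Context: $\langle\cdot,\cdot\rangle$ and $|\cdot|$ are the Euclidean inner product and norm on $\mathbb{R}^4$, $S^3$ is the unit sphere in $\mathbb{R}^4$, and $\Delta$ is the classical Laplacian on $\mathbb{R}^4$ (the Dunkl Laplacian for $k=0$). The branch of $\sqrt z$ is such that $\sqrt z>0$ when $z>0$. The theta function is $$\vartheta(v,\tau)=\sum_{m=-\infty}^\infty\exp(\mathrm{i}\pi\tau m^2+2\mathrm{i}\pi mv)=1+2\sum_{m=1}^\infty\exp(\mathrm{i}\pi\tau m^2)\cos2\pi mv.$$ Let $C_m^1$ be the Gegenbauer polynomials defined by $(1-2t\xi+\xi^2)^{-1}=\sum_{m=0}^\infty C_m^1(t)\xi^m$, and put $\widetilde{C}_m^1(t)=(m+1)C_m^1(t)$. For $\operatorname{Re}z>0$, $r,r'>0$, $\omega,\omega'\in S^3$, the kernel is $$K_0(r\omega,r'\omega';z)=\frac{1}{\sqrt{4\pi z}}\exp\Bigl(-\frac{(\log r-\log r')^2}{4z}\Bigr)(rr')^{-1}\cdot\frac{1}{2\pi^2}\sum_{m=0}^\infty\exp\bigl(-z(m+1)^2\bigr)\widetilde{C}_m^1(\langle\omega,\omega'\rangle);$$ it is the integral kernel, with respect to the measure $|x'|^{-2}dx'$, of the bounded operator $\exp(z|x|^2\Delta)$ on $L^2(\mathbb{R}^4,|x|^{-2}dx)$, where $|x|^2\Delta$ is regarded as a self-adjoint operator, namely the closure of its restriction to the span of the functions $r\omega\mapsto p(\omega)f(r)$ with $p$ the restriction to $S^3$ of a polynomial and $f\in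 C_{\mathrm c}^\infty(\mathbb{R}_{>0})$. *)

theory Defs
  imports "HOL-Analysis.Analysis" "HOL-Computational_Algebra.Formal_Power_Series"
begin

definition theta :: "complex \<Rightarrow> complex \<Rightarrow> complex" where
  "theta v \<tau> =
     (\<Sum>\<^sub>\<infinity>m\<in>(UNIV :: int set). exp (\<i> * of_real pi * \<tau> * of_int m ^ 2 + 2 * \<i> * of_real pi * of_int m * v))"

text \<open>The value at \<open>t\<close> of the Gegenbauer polynomial of degree \<open>m\<close> and index \<open>1\<close> is the
  coefficient of \<open>\<xi>\<close> to the power \<open>m\<close> in the inverse of \<open>1 - 2 t \<xi> + \<xi>\<^sup>2\<close>.\<close>

definition gegenbauer1 :: "nat \<Rightarrow> real \<Rightarrow> real" where
  "gegenbauer1 m t = fps_nth (inverse (1 - fps_const (2 * t) * fps_X + fps_X ^ 2)) m"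

definition gegenbauer1_tilde :: "nat \<Rightarrow> real \<Rightarrow> real" where
  "gegenbauer1_tilde m t = (real m + 1) * gegenbauer1 m t"

text \<open>The kernel, with respect to the measure with density \<open>1 / (norm x')\<^sup>2\<close>, of the operator
  exponential of \<open>z\<close> times \<open>(norm x)\<^sup>2\<close> times the Laplacian on four-dimensional space. It is
  meaningful for \<open>Re z > 0\<close> and nonzero \<open>x\<close>, \<open>x'\<close>; the polar coordinates of \<open>x\<close> are \<open>norm x\<close> and
  \<open>sgn x = x /\<^sub>R norm x\<close>. The principal branch \<open>csqrt\<close> is positive on positive reals and continuous
  on the right half-plane.\<close>

definition K0 :: "real ^ 4 \<Rightarrow> real ^ 4 \<Rightarrow> complex \<Rightarrow> complex" where
  "K0 x x' z =
     1 / csqrt (4 * of_real pi * z)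
     * exp (- complex_of_real ((ln (norm x) - ln (norm x')) ^ 2) / (4 * z))
     * of_real (inverse (norm x * norm x'))
     * (1 / (2 * of_real pi ^ 2))
     * (\<Sum>m. exp (- z * (of_nat m + 1) ^ 2) * of_real (gegenbauer1_tilde m (sgn x \<bullet> sgn x')))"

end

theory Submission
  imports Defs "HOL-Real_Asymp.Real_Asymp"
begin

text \<open>With \<open>t = cos \<theta>\<close>, the Gegenbauer polynomials of index \<open>1\<close> satisfy
  \<open>C\<^sub>m(t) sin \<theta> = sin ((m + 1) \<theta>)\<close>. Differentiating the cosine series of the theta function term by
  term at \<open>v = \<theta> / (2 \<pi>)\<close> therefore yields \<open>- 4 \<pi> sin \<theta>\<close> times the series of the kernel. By
  \<open>\<bar>C\<^sub>m(t)\<bar> \<le> m + 1\<close> and the Weierstrass M-test that series is continuous in \<open>t\<close> up to \<open>t = \<plusminus>1\<close>.\<close>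

section \<open>Gegenbauer polynomials of index 1: recurrence, trigonometric form, bound\<close>

lemma gegenbauer1_rec:
  shows gegenbauer1_0: "gegenbauer1 0 t = 1"
    and gegenbauer1_1: "gegenbauer1 (Suc 0) t = 2 * t"
    and gegenbauer1_Suc_Suc:
      "gegenbauer1 (Suc (Suc m)) t = 2 * t * gegenbauer1 (Suc m) t - gegenbauer1 m t"
proof -
  define q :: "real fps" where "q = inverse (1 - fps_const (2 * t) * fps_X + fps_X ^ 2)"
  have "q * (1 - fps_const (2 * t) * fps_X + fps_X ^ 2) = 1"
    unfolding q_def by (rule inverse_mult_eq_1) simp
  then have eq: "q = 1 + fps_const (2 * t) * (fps_X * q) - fps_X ^ 2 * q"
    by (simp add: algebra_simps)
  \<comment> \<open>Coefficients of \<open>eq\<close>. The guards \<open>n = 0\<close> and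
    \<open>n < 2\<close> express the shifts by \<open>fps_X\<close> and \<open>fps_X ^ 2\<close>,
    since subtraction on naturals truncates.\<close>
  have q: "fps_nth q n = (if n = 0 then 1 else 0) + 2 * t * (if n = 0 then 0 else fps_nth q (n - 1))
      - (if n < 2 then 0 else fps_nth q (n - 2))" for n
    using arg_cong[OF eq, of "\<lambda>f. fps_nth f n"]
    by (simp add: fps_X_power_mult_nth)
  show "gegenbauer1 0 t = 1" "gegenbauer1 (Suc 0) t = 2 * t"
    "gegenbauer1 (Suc (Suc m)) t = 2 * t * gegenbauer1 (Suc m) t - gegenbauer1 m t"
    using q[of 0] q[of 1] q[of "Suc (Suc m)"] by (simp_all add: gegenbauer1_def q_def)
qed

lemma sin_mult_gegenbauer1: "sin \<theta> * gegenbauer1 m (cos \<theta>) = sin ((real m + 1) * \<theta>)"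
proof (induction m rule: induct_nat_012)
  case (ge2 n)
  have "sin \<theta> * gegenbauer1 (Suc (Suc n)) (cos \<theta>)
      = 2 * cos \<theta> * (sin \<theta> * gegenbauer1 (Suc n) (cos \<theta>)) - sin \<theta> * gegenbauer1 n (cos \<theta>)"
    by (simp add: gegenbauer1_Suc_Suc algebra_simps)
  \<comment> \<open>The angle \<open>(n + 1) \<theta>\<close> is written as
    \<open>(n + 2) \<theta> - \<theta>\<close>, so that the formulas for
    \<open>sin (A + \<theta>)\<close> and \<open>sin (A - \<theta>)\<close> with
    \<open>A = (n + 2) \<theta>\<close> combine.\<close>
  also have "\<dots> = 2 * cos \<theta> * sin ((real n + 2) * \<theta>) - sin ((real n + 2) * \<theta> - \<theta>)"
    using ge2 by (simp add: algebra_simps)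
  also have "\<dots> = sin ((real n + 2) * \<theta> + \<theta>)"
    unfolding sin_add sin_diff by simp
  finally show ?case
    by (simp add: algebra_simps)
qed (simp_all add: gegenbauer1_0 gegenbauer1_1 sin_double)

text \<open>Formally this is the addition formula for
  \<open>sin ((m + 1) \<theta> + \<theta>)\<close> divided by \<open>sin \<theta>\<close>. Induction
  along the recurrence avoids the division, so zeros of \<open>sin \<theta>\<close> are
  included.\<close>

lemma gegenbauer1_Suc_cos:
  "gegenbauer1 (Suc m) (cos \<theta>) = cos \<theta> * gegenbauer1 m (cos \<theta>) + cos ((real m + 1) * \<theta>)"
proof (induction m)
  case (Suc m)
  \<comment> \<open>The recurrence contributes \<open>2 * cos \<theta>\<close>. One of the two
    copies already stands on the right of the goal, and the rest must become the cosine of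
    \<open>(m + 2) \<theta>\<close>.\<close>
  have "cos \<theta> * gegenbauer1 (Suc m) (cos \<theta>) - gegenbauer1 m (cos \<theta>)
      = cos \<theta> * cos ((real m + 1) * \<theta>) - (1 - (cos \<theta>)\<^sup>2) * gegenbauer1 m (cos \<theta>)"
    unfolding Suc by (simp add: algebra_simps power2_eq_square)
  also have "\<dots> = cos \<theta> * cos ((real m + 1) * \<theta>) - sin \<theta> * (sin \<theta> * gegenbauer1 m (cos \<theta>))"
    unfolding sin_squared_eq[symmetric] by (simp add: power2_eq_square)
  also have "\<dots> = cos ((real m + 1) * \<theta> + \<theta>)"
    unfolding sin_mult_gegenbauer1 cos_add by simp
  finally show ?case
    by (simp add: gegenbauer1_Suc_Suc algebra_simps)
qed (simp add: gegenbauer1_0 gegenbauer1_1)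

text \<open>Each step of \<open>gegenbauer1_Suc_cos\<close> raises the absolute value by at most 1,
  and every \<open>t\<close> in \<open>[-1, 1]\<close> is a cosine.\<close>

lemma abs_gegenbauer1_le:
  assumes "\<bar>t\<bar> \<le> 1"
  shows "\<bar>gegenbauer1 m t\<bar> \<le> real m + 1"
proof -
  have "\<bar>gegenbauer1 m (cos \<theta>)\<bar> \<le> real m + 1" for \<theta>
  proof (induction m)
    case (Suc m)
    have "\<bar>gegenbauer1 (Suc m) (cos \<theta>)\<bar> \<le> \<bar>cos \<theta>\<bar> * \<bar>gegenbauer1 m (cos \<theta>)\<bar> + \<bar>cos ((real m + 1) * \<theta>)\<bar>"
      unfolding gegenbauer1_Suc_cos by (metis abs_mult abs_triangle_ineq)
    also have "\<dots> \<le> 1 * (real m + 1) + 1"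
      using Suc by (intro add_mono mult_mono) auto
    finally show ?case by simp
  qed (simp add: gegenbauer1_0)
  from this[of "arccos t"] assms show ?thesis by (simp add: cos_arccos_abs)
qed

lemma continuous_on_gegenbauer1: "continuous_on A (\<lambda>t. gegenbauer1 m t)"
  by (induction m rule: induct_nat_012)
    (simp_all add: gegenbauer1_0 gegenbauer1_1 gegenbauer1_Suc_Suc continuous_intros)

section \<open>Convergence of Gaussian series\<close>

text \<open>The common majorant of all later series: the linear term \<open>b\<close> absorbs the
  growth of exponentials and sines at complex \<open>v\<close>, the square absorbs the factors from
  differentiation and from \<open>gegenbauer1_tilde\<close>.\<close>

lemma summable_square_mult_gaussian:
  fixes a b :: real
  assumes "a > 0"
  shows "summable (\<lambda>m. (real m + 1) ^ 2 * exp (- a * (real m + 1) ^ 2 + b * (real m + 1)))"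
proof (rule summable_comparison_test_bigo)
  show "summable (\<lambda>m. norm (1 / real m ^ 2))"
    using inverse_power_summable[of 2] by (simp add: field_simps)
  \<comment> \<open>The comparison is asymptotic, so the value \<open>1 / 0 = 0\<close> at
    \<open>m = 0\<close> does no harm.\<close>
  show "(\<lambda>m. (real m + 1) ^ 2 * exp (- a * (real m + 1) ^ 2 + b * (real m + 1))) \<in> O(\<lambda>m. 1 / real m ^ 2)"
    using assms by real_asymp
qed


lemma summable_gaussian:
  fixes a b :: real
  assumes "a > 0"
  shows "summable (\<lambda>m. exp (- a * (real m + 1) ^ 2 + b * (real m + 1)))"
proof (rule summable_comparison_test[OF _ summable_square_mult_gaussian[OF assms]], intro exI allI impI)
  fix m :: nat
  have "1 * exp (- a * (real m + 1) ^ 2 + b * (real m + 1))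
      \<le> (real m + 1) ^ 2 * exp (- a * (real m + 1) ^ 2 + b * (real m + 1))"
    by (intro mult_right_mono) auto
  then show "norm (exp (- a * (real m + 1) ^ 2 + b * (real m + 1)))
      \<le> (real m + 1) ^ 2 * exp (- a * (real m + 1) ^ 2 + b * (real m + 1))"
    by simp
qed

lemma norm_exp_gaussian: "norm (exp (- z * (of_nat m + 1) ^ 2)) = exp (- Re z * (real m + 1) ^ 2)"
proof -
  have "(of_nat m + 1) ^ 2 = complex_of_real ((real m + 1) ^ 2)"
    by simp
  then show ?thesis
    by (simp only: norm_exp_eq_Re) simp
qed

section \<open>The theta function: cosine series and derivative\<close>

text \<open>Passes from the unordered sum over the integers in \<open>theta\<close> to an ordinary
  series by pairing opposite indices. Absolute convergence turns the two half series into unordered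
  sums over disjoint ranges.\<close>

lemma has_sum_int_symmetric:
  fixes f :: "int \<Rightarrow> 'a :: banach"
  assumes "summable (\<lambda>m. norm (f (int m + 1)))"
    and "summable (\<lambda>m. norm (f (- (int m + 1))))"
  shows "(f has_sum (f 0 + (\<Sum>m. f (int m + 1) + f (- (int m + 1))))) UNIV"
proof -
  have "((f \<circ> (\<lambda>m. int m + 1)) has_sum (\<Sum>m. f (int m + 1))) UNIV"
    "((f \<circ> (\<lambda>m. - (int m + 1))) has_sum (\<Sum>m. f (- (int m + 1)))) UNIV"
    unfolding o_def using assms
    by (auto intro!: norm_summable_imp_has_sum summable_sums dest: summable_norm_cancel)
  then have P: "(f has_sum (\<Sum>m. f (int m + 1))) (range (\<lambda>m. int m + 1))"
    and N: "(f has_sum (\<Sum>m. f (- (int m + 1)))) (range (\<lambda>m. - (int m + 1)))"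
    by (subst has_sum_reindex; simp add: inj_on_def)+
  have Z: "(f has_sum f 0) {0}"
    using has_sum_finite[of "{0}" f] by simp
  have UN: "UNIV = {0} \<union> (range (\<lambda>m. int m + 1) \<union> range (\<lambda>m. - (int m + 1)))"
  proof (intro set_eqI iffI UNIV_I)
    fix k :: int
    \<comment> \<open>\<open>nat (k - 1)\<close> and \<open>nat (- k - 1)\<close> are the preimages
      of a positive and of a negative \<open>k\<close>.\<close>
    consider "k = 0" | "k = int (nat (k - 1)) + 1" | "k = - (int (nat (- k - 1)) + 1)"
      by linarith
    then show "k \<in> {0} \<union> (range (\<lambda>m. int m + 1) \<union> range (\<lambda>m. - (int m + 1)))"
      by cases blast+
  qed
  have "range (\<lambda>m. int m + 1) \<inter> range (\<lambda>m. - (int m + 1)) = {}"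
    "{0} \<inter> (range (\<lambda>m. int m + 1) \<union> range (\<lambda>m. - (int m + 1))) = {}"
    by auto
  from has_sum_Un_disjoint[OF Z has_sum_Un_disjoint[OF P N this(1)] this(2)]
  have "(f has_sum (f 0 + ((\<Sum>m. f (int m + 1)) + (\<Sum>m. f (- (int m + 1)))))) UNIV"
    by (simp only: UN[symmetric])
  also have "(\<Sum>m. f (int m + 1)) + (\<Sum>m. f (- (int m + 1))) = (\<Sum>m. f (int m + 1) + f (- (int m + 1)))"
    by (intro suminf_add assms[THEN summable_norm_cancel])
  finally show ?thesis .
qed

text \<open>For this second argument the quadratic exponent is \<open>- z * m ^ 2\<close>, equal at
  \<open>m\<close> and \<open>- m\<close>, so Euler's formula turns each pair of exponentials into a
  cosine.\<close>

lemma theta_eq_cos_series: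
  assumes "Re z > 0"
  shows "theta v (\<i> / of_real pi * z)
    = 1 + (\<Sum>m. 2 * exp (- z * (of_nat m + 1) ^ 2) * cos (2 * of_real pi * (of_nat m + 1) * v))"
proof -
  define f :: "int \<Rightarrow> complex" where "f m = exp (\<i> * of_real pi * (\<i> / of_real pi * z) * of_int m ^ 2
     + 2 * \<i> * of_real pi * of_int m * v)" for m
  define w where "w m = 2 * of_real pi * (of_nat m + 1) * v" for m :: nat
  have f_pos: "f (int m + 1) = exp (- z * (of_nat m + 1) ^ 2) * exp (\<i> * w m)" for m
    by (simp add: f_def w_def flip: exp_add) (simp add: mult_ac)
  have f_neg: "f (- (int m + 1)) = exp (- z * (of_nat m + 1) ^ 2) * exp (- (\<i> * w m))" for m
    by (simp add: f_def w_def algebra_simps power2_eq_square flip: exp_add)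
  have "norm (w m) = 2 * pi * norm v * (real m + 1)" for m
    using norm_of_nat[of "Suc m", where 'a = complex] by (simp add: w_def norm_mult add.commute)
  \<comment> \<open>Bounding \<open>exp y\<close> by \<open>exp (norm y)\<close> yields one majorant
    for both signs of the index.\<close>
  then have "norm (exp (- z * (of_nat m + 1) ^ 2) * exp y)
      \<le> exp (- Re z * (real m + 1) ^ 2 + 2 * pi * norm v * (real m + 1))" if "norm y = norm (w m)" for m y
    using norm_exp[of y] that unfolding norm_mult norm_exp_gaussian exp_add by (intro mult_left_mono) auto
  then have le: "norm (f (int m + 1)) \<le> exp (- Re z * (real m + 1) ^ 2 + 2 * pi * norm v * (real m + 1))"
    "norm (f (- (int m + 1))) \<le> exp (- Re z * (real m + 1) ^ 2 + 2 * pi * norm v * (real m + 1))" for m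
    unfolding f_pos f_neg by (simp_all only: norm_minus_cancel norm_mult norm_ii mult_1)
  have "(f has_sum (f 0 + (\<Sum>m. f (int m + 1) + f (- (int m + 1))))) UNIV"
    by (rule has_sum_int_symmetric; rule summable_comparison_test'[OF
          summable_gaussian[OF assms, of "2 * pi * norm v"], of 0])
      (simp_all only: real_norm_def abs_norm_cancel le)
  then have "theta v (\<i> / of_real pi * z) = f 0 + (\<Sum>m. f (int m + 1) + f (- (int m + 1)))"
    unfolding theta_def f_def by (rule infsumI)
  also have "(\<lambda>m. f (int m + 1) + f (- (int m + 1)))
      = (\<lambda>m. 2 * exp (- z * (of_nat m + 1) ^ 2) * cos (w m))"
    unfolding f_pos f_neg cos_exp_eq by (simp flip: distrib_left)
  finally show ?thesis
    by (simp add: f_def w_def)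
qed

text \<open>Termwise differentiation of the cosine series, justified by the M-test for the
  differentiated series on a ball containing \<open>v\<close>.\<close>

lemma has_field_derivative_theta:
  assumes "Re z > 0"
  shows "((\<lambda>v. theta v (\<i> / of_real pi * z)) has_field_derivative
    (\<Sum>m. - 4 * of_real pi * (of_nat m + 1) * exp (- z * (of_nat m + 1) ^ 2)
      * sin (2 * of_real pi * (of_nat m + 1) * v))) (at v)"
proof -
  define c where "c m = 2 * exp (- z * (of_nat m + 1) ^ 2)" for m :: nat
  define k where "k m = 2 * of_real pi * (of_nat m + 1 :: complex)" for m :: nat
  \<comment> \<open>\<open>B * (real m + 1)\<close> bounds \<open>norm (k m * x)\<close> on the ball
    of radius \<open>norm v + 1\<close>, hence its exponential bounds the sine there.\<close>
  define B where "B = 2 * pi * (norm v + 1)"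
  have norm_Suc: "norm (of_nat m + 1 :: complex) = real m + 1" for m
    using norm_of_nat[of "Suc m", where 'a = complex] by (simp add: add.commute)
  have "((\<lambda>v. \<Sum>m. c m * cos (k m * v)) has_field_derivative (\<Sum>m. - c m * k m * sin (k m * v))) (at v)"
  proof (rule has_field_derivative_series'(2))
    show "((\<lambda>v. c m * cos (k m * v)) has_field_derivative - c m * k m * sin (k m * x))
        (at x within ball 0 (norm v + 1))" for m x
      by (auto intro!: derivative_eq_intros)
    show "uniformly_convergent_on (ball 0 (norm v + 1)) (\<lambda>n x. \<Sum>m<n. - c m * k m * sin (k m * x))"
    proof (rule Weierstrass_m_test')
      show "summable (\<lambda>m. 4 * pi * ((real m + 1) ^ 2 * exp (- Re z * (real m + 1) ^ 2 + B * (real m + 1))))"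
        by (intro summable_mult summable_square_mult_gaussian assms)
      fix m and x :: complex assume "x \<in> ball 0 (norm v + 1)"
      then have x: "norm x \<le> norm v + 1" by simp
      have "norm (sin (k m * x)) \<le> exp (norm (k m * x))"
        using cmod_sin_le_exp[of 1 "k m * x"] abs_Im_le_cmod[of "k m * x"]
        by (smt (verit) exp_le_cancel_iff scaleR_one)
      also have "norm (k m * x) = 2 * pi * (real m + 1) * norm x"
        by (simp add: k_def norm_mult norm_Suc)
      also have "\<dots> \<le> 2 * pi * (real m + 1) * (norm v + 1)"
        using x by (intro mult_left_mono) auto
      also have "\<dots> = B * (real m + 1)"
        by (simp add: B_def)
      finally have sin_le: "norm (sin (k m * x)) \<le> exp (B * (real m + 1))"
        by simp
      have "norm (- c m * k m * sin (k m * x))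
          = 4 * pi * ((real m + 1) * exp (- Re z * (real m + 1) ^ 2) * norm (sin (k m * x)))"
        unfolding c_def k_def norm_mult norm_minus_cancel norm_exp_gaussian norm_Suc by simp
      also have "\<dots> \<le> 4 * pi * ((real m + 1) ^ 2 * exp (- Re z * (real m + 1) ^ 2) * exp (B * (real m + 1)))"
        using sin_le by (intro mult_left_mono mult_mono) (auto simp: power2_eq_square)
      finally show "norm (- c m * k m * sin (k m * x))
          \<le> 4 * pi * ((real m + 1) ^ 2 * exp (- Re z * (real m + 1) ^ 2 + B * (real m + 1)))"
        by (simp only: exp_add mult.assoc)
    qed
    \<comment> \<open>The undifferentiated series must converge at one point of the ball. At 0 all
      cosines are 1.\<close>
    have "summable (\<lambda>m. 2 * exp (- Re z * (real m + 1) ^ 2 + 0 * (real m + 1)))"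
      by (intro summable_mult summable_gaussian assms)
    moreover have "norm (c m) = 2 * exp (- Re z * (real m + 1) ^ 2 + 0 * (real m + 1))" for m
      unfolding c_def norm_mult norm_exp_gaussian by simp
    ultimately show "summable (\<lambda>m. c m * cos (k m * 0))"
      by (intro summable_norm_cancel[of "\<lambda>m. c m * cos (k m * 0)"]) simp
  qed (auto simp: add_nonneg_pos)
  from DERIV_add[OF DERIV_const[of 1] this]
  have "((\<lambda>v. 1 + (\<Sum>m. c m * cos (k m * v))) has_field_derivative
      (\<Sum>m. - c m * k m * sin (k m * v))) (at v)"
    by simp
  moreover have "- 4 * of_real pi * (of_nat m + 1) * exp (- z * (of_nat m + 1) ^ 2)
      * sin (2 * of_real pi * (of_nat m + 1) * v) = - c m * k m * sin (k m * v)" for m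
    by (simp add: c_def k_def)
  ultimately show ?thesis
    by (simp only: theta_eq_cos_series[OF assms] c_def k_def)
qed

section \<open>The kernel series and the theta derivative\<close>

text \<open>The angular series of \<open>K0\<close>, isolated as a function of the inner product so
  that its continuity in \<open>t\<close> can be used.\<close>

definition gegenbauer_series :: "complex \<Rightarrow> real \<Rightarrow> complex" where
  "gegenbauer_series z t = (\<Sum>m. exp (- z * (of_nat m + 1) ^ 2) * of_real (gegenbauer1_tilde m t))"

text \<open>One factor \<open>m + 1\<close> comes from \<open>abs_gegenbauer1_le\<close>, the other
  from \<open>gegenbauer1_tilde\<close>. The zero linear term matches
  \<open>summable_square_mult_gaussian\<close> with \<open>b = 0\<close>.\<close>

lemma norm_gegenbauer_term_le:
  assumes "\<bar>t\<bar> \<le> 1"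
  shows "norm (exp (- z * (of_nat m + 1) ^ 2) * of_real (gegenbauer1_tilde m t))
    \<le> (real m + 1) ^ 2 * exp (- Re z * (real m + 1) ^ 2 + 0 * (real m + 1))"
proof -
  have "\<bar>gegenbauer1_tilde m t\<bar> \<le> (real m + 1) ^ 2"
    using abs_gegenbauer1_le[OF assms, of m] by (simp add: gegenbauer1_tilde_def abs_mult power2_eq_square)
  then show ?thesis
    unfolding norm_mult norm_exp_gaussian by (simp add: mult.commute)
qed

lemma continuous_on_gegenbauer_series:
  assumes "Re z > 0"
  shows "continuous_on {-1..1} (gegenbauer_series z)"
proof -
  have "uniform_limit {-1..1} (\<lambda>n t. \<Sum>m<n. exp (- z * (of_nat m + 1) ^ 2) * of_real (gegenbauer1_tilde m t))
      (gegenbauer_series z) sequentially"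
    unfolding gegenbauer_series_def
  proof (rule Weierstrass_m_test)
    show "summable (\<lambda>m. (real m + 1) ^ 2 * exp (- Re z * (real m + 1) ^ 2 + 0 * (real m + 1)))"
      by (intro summable_square_mult_gaussian assms)
  qed (intro norm_gegenbauer_term_le, auto)
  then show ?thesis
    by (rule uniform_limit_theorem[rotated])
      (unfold gegenbauer1_tilde_def, simp, intro always_eventually allI continuous_intros continuous_on_gegenbauer1)
qed

text \<open>Every term of the derivative carries the same factor \<open>sin \<theta>\<close>, which
  cancels the power of \<open>1 - t ^ 2\<close>. This is where \<open>t\<close> must lie strictly
  inside the interval.\<close>

lemma deriv_theta_arccos:
  assumes z: "Re z > 0" and t: "-1 < t" "t < 1"
  shows "of_real ((1 - t ^ 2) powr (- 1 / 2))
      * deriv (\<lambda>v. theta v (\<i> / of_real pi * z)) (of_real (1 / (2 * pi) * arccos t))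
    = - 4 * of_real pi * gegenbauer_series z t"
proof -
  define \<theta> where "\<theta> = arccos t"
  have cos: "cos \<theta> = t" and sin: "sin \<theta> = sqrt (1 - t ^ 2)"
    using t by (simp_all add: \<theta>_def sin_arccos)
  have less: "t ^ 2 < 1"
    using t by (simp add: abs_square_less_1)
  have powr: "(1 - t ^ 2) powr (- 1 / 2) = 1 / sin \<theta>"
    using less by (simp add: sin powr_minus_divide powr_half_sqrt)
  have nz: "sin \<theta> \<noteq> 0"
    using less by (simp add: sin)
  have arg: "2 * of_real pi * (of_nat m + 1) * of_real (1 / (2 * pi) * arccos t)
      = (of_real ((real m + 1) * \<theta>) :: complex)" for m
    by (simp add: \<theta>_def)
  have term_eq: "- 4 * of_real pi * (of_nat m + 1) * exp (- z * (of_nat m + 1) ^ 2)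
      * sin (2 * of_real pi * (of_nat m + 1) * of_real (1 / (2 * pi) * arccos t))
    = (- 4 * of_real pi * of_real (sin \<theta>))
      * (exp (- z * (of_nat m + 1) ^ 2) * of_real (gegenbauer1_tilde m t))" for m
    unfolding arg sin_of_real sin_mult_gegenbauer1[symmetric] cos gegenbauer1_tilde_def
    by simp
  have "summable (\<lambda>m. exp (- z * (of_nat m + 1) ^ 2) * of_real (gegenbauer1_tilde m t))"
    by (rule summable_comparison_test'[OF summable_square_mult_gaussian[OF z] norm_gegenbauer_term_le])
      (use t in auto)
  then have "deriv (\<lambda>v. theta v (\<i> / of_real pi * z)) (of_real (1 / (2 * pi) * arccos t))
      = (- 4 * of_real pi * of_real (sin \<theta>)) * gegenbauer_series z t"
    unfolding DERIV_imp_deriv[OF has_field_derivative_theta[OF z]] term_eq gegenbauer_series_def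
    by (rule suminf_mult)
  with nz show ?thesis
    unfolding powr by simp
qed

(* At inner product 1 or -1 the closed formula has the indeterminate form "infinity times 0";
   there it is read as its continuous extension, which the second conjunct states. *)
theorem proposition4p3:
  fixes z :: complex and r r' :: real and \<omega> \<omega>' :: "real ^ 4"
  assumes "Re z > 0" and "r > 0" and "r' > 0"
    and "\<omega> \<in> sphere 0 1" and "\<omega>' \<in> sphere 0 1"
  shows "(\<omega> \<bullet> \<omega>' \<noteq> 1 \<and> \<omega> \<bullet> \<omega>' \<noteq> - 1 \<longrightarrow>
      K0 (r *\<^sub>R \<omega>) (r' *\<^sub>R \<omega>') z =
        - (1 / (8 * of_real pi ^ 3 * csqrt (4 * of_real pi * z)))
        * exp (- complex_of_real ((ln r - ln r') ^ 2) / (4 * z))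
        * of_real (inverse (r * r'))
        * of_real ((1 - (\<omega> \<bullet> \<omega>') ^ 2) powr (- 1 / 2))
        * deriv (\<lambda>v. theta v (\<i> / of_real pi * z)) (of_real (1 / (2 * pi) * arccos (\<omega> \<bullet> \<omega>')))) \<and>
    (\<omega> \<bullet> \<omega>' = 1 \<or> \<omega> \<bullet> \<omega>' = - 1 \<longrightarrow>
      ((\<lambda>t.
        - (1 / (8 * of_real pi ^ 3 * csqrt (4 * of_real pi * z)))
        * exp (- complex_of_real ((ln r - ln r') ^ 2) / (4 * z))
        * of_real (inverse (r * r'))
        * of_real ((1 - t ^ 2) powr (- 1 / 2))
        * deriv (\<lambda>v. theta v (\<i> / of_real pi * z)) (of_real (1 / (2 * pi) * arccos t)))
       \<longlongrightarrow> K0 (r *\<^sub>R \<omega>) (r' *\<^sub>R \<omega>') z) (at (\<omega> \<bullet> \<omega>') within {- 1<..<1}))"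
proof -
  define C where "C = - (1 / (8 * of_real pi ^ 3 * csqrt (4 * of_real pi * z)))
    * exp (- complex_of_real ((ln r - ln r') ^ 2) / (4 * z)) * of_real (inverse (r * r'))"
  define F where "F t = C * of_real ((1 - t ^ 2) powr (- 1 / 2))
    * deriv (\<lambda>v. theta v (\<i> / of_real pi * z)) (of_real (1 / (2 * pi) * arccos t))" for t
  have unit: "norm \<omega> = 1" "norm \<omega>' = 1"
    using assms by auto
  then have "\<bar>\<omega> \<bullet> \<omega>'\<bar> \<le> 1"
    using Cauchy_Schwarz_ineq2[of \<omega> \<omega>'] by simp
  then have range: "-1 \<le> \<omega> \<bullet> \<omega>'" "\<omega> \<bullet> \<omega>' \<le> 1" by auto
  \<comment> \<open>The constants agree because \<open>-1 / (8 pi^3)\<close> times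
    \<open>- 4 pi\<close> is \<open>1 / (2 pi^2)\<close>. As \<open>r\<close>, \<open>r'\<close> are
    positive and the vectors are unit, \<open>sgn\<close> and \<open>norm\<close> recover the polar
    coordinates.\<close>
  have K0: "K0 (r *\<^sub>R \<omega>) (r' *\<^sub>R \<omega>') z = C * (- 4 * of_real pi * gegenbauer_series z (\<omega> \<bullet> \<omega>'))"
    using assms unit
    by (simp add: K0_def C_def gegenbauer_series_def sgn_div_norm field_simps power3_eq_cube power2_eq_square)
  have F: "F t = C * (- 4 * of_real pi * gegenbauer_series z t)" if "-1 < t" "t < 1" for t
    unfolding F_def mult.assoc deriv_theta_arccos[OF assms(1) that] ..
  \<comment> \<open>Continuity on the closed interval supplies the limit even at an endpoint.
    Restricting to the open interval then allows the replacement by \<open>F\<close>, whose series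
    form holds only there.\<close>
  have "continuous_on {-1..1} (\<lambda>t. C * (- 4 * of_real pi * gegenbauer_series z t))"
    by (intro continuous_intros continuous_on_gegenbauer_series assms)
  then have "((\<lambda>t. C * (- 4 * of_real pi * gegenbauer_series z t)) \<longlongrightarrow> K0 (r *\<^sub>R \<omega>) (r' *\<^sub>R \<omega>') z)
      (at (\<omega> \<bullet> \<omega>') within {-1..1})"
    using range unfolding K0 continuous_on_def by auto
  then have "((\<lambda>t. C * (- 4 * of_real pi * gegenbauer_series z t)) \<longlongrightarrow> K0 (r *\<^sub>R \<omega>) (r' *\<^sub>R \<omega>') z)
      (at (\<omega> \<bullet> \<omega>') within {-1<..<1})"
    by (rule tendsto_within_subset) auto
  then have lim: "(F \<longlongrightarrow> K0 (r *\<^sub>R \<omega>) (r' *\<^sub>R \<omega>') z) (at (\<omega> \<bullet> \<omega>') within {-1<..<1})"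
    by (rule Lim_transform_eventually) (auto simp: eventually_at_filter F)
  have "K0 (r *\<^sub>R \<omega>) (r' *\<^sub>R \<omega>') z = F (\<omega> \<bullet> \<omega>')" if "\<omega> \<bullet> \<omega>' \<noteq> 1" "\<omega> \<bullet> \<omega>' \<noteq> - 1"
    unfolding K0 using that range by (intro F[symmetric]) auto
  with lim show ?thesis
    unfolding F_def C_def by blast
qed

end
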